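(* Let $k\geq 2$ and $r\geq 1$ be integers. Then, as formal power series, $$T_k(x_1,x_2,\ldots,x_r)=\frac{x_1\cdot Q_k(x_2,\ldots,x_r)}{Q_k(x_1,\ldots,x_r)},$$ where for $r=1$ the polynomial $Q_k(x_2,\ldots,x_r)$ (indexed by the empty interval) equals $1$.
   Context: Let $k\geq 2$, $n\geq 0$. An augmented $k$-Catalan path of order $n$ is a lattice path $(0,z_0),(1,z_1),\ldots,(kn+1,z_{kn+1})$ with $z_0=0$, each step $(1,z_i-z_{i-1})$ being either an up step $(1,1)$ or a down step $(1,1-k)$, consisting of $(k-1)n+1$ up steps and $n$ down steps, whose first step is an up step, and with $z_i\geq 1$ for all $1\leq i\leq kn+1$ (so $z_{kn+1}=1$). The level of the lattice point $(i,z_i)$ is $z_i$. For a vector $\overline{\imath}=(i_1,\ldots,i_r)$ of nonnegative integers with $i_1\geq 1$, an augmented $k$-Catalan path (of any order $n\geq 0$) has type $\overline{\imath}$ if for each $j\in\{1,\ldots,r\}$ exactly $i_j$ of its lattice points $(1,z_1),\ldots,(kn+1,z_{kn+1})$ lie at level $j$ and none of them lies at a level greater than $r$. Let $t_k(\overline{\imath})$ be the number of augmented $k$-Catalan paths of type $\overline{\imath}$, and define the formal power series $T_k(x_1,\ldots,x_r)=\sum_{\overline{\imath}\in\mathbb{P}\times\mathbb{N}^{r-1}} t_k(\overline{\imath})\, x_1^{i_1}\cdots x_r^{i_r}$, where $\mathbb{P}$ denotes the positive integers and $\mathbb{N}$ the nonnegative integers. For a finite set $S$ of positive integers write $x_S=\prod_{i\in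 S}x_i$. For integers $a,b$, the $k$-Catalan denominator polynomial is $Q_k(x_a,x_{a+1},\ldots,x_b)=\sum_S (-1)^{|S|/k}x_S$, where $S$ ranges over all subsets of $\{a,a+1,\ldots,b\}$ that are disjoint unions of sets each consisting of $k$ consecutive integers (the empty set included, contributing $1$). *)

theory Defs
  imports "HOL-Library.Poly_Mapping" "HOL-Library.Disjoint_Sets"
begin

text \<open>
  Formal power series in the variables \<open>x\<^sub>0, x\<^sub>1, x\<^sub>2, \<dots>\<close>, given by their coefficients on
  finitely supported exponent vectors. For each \<open>r\<close>, the series whose coefficients vanish off
  the exponent vectors supported in \<open>{1..r}\<close> form the ring of formal power series in
  \<open>x\<^sub>1, \<dots>, x\<^sub>r\<close>.
\<close>

typedef 'a mfps = "UNIV :: ((nat \<Rightarrow>\<^sub>0 nat) \<Rightarrow> 'a) set"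
  morphisms mcoeff Abs_mfps ..

setup_lifting type_definition_mfps

lemma mfps_eqI: "(\<And>m. mcoeff f m = mcoeff g m) \<Longrightarrow> f = g"
  by (metis ext mcoeff_inject)

lemma finite_le_exponent: "finite {a :: nat \<Rightarrow>\<^sub>0 nat. \<exists>b. a + b = m}"
proof -
  let ?F = "{f. \<forall>i. (i \<in> Poly_Mapping.keys m \<longrightarrow> f i \<in> {..Max (Poly_Mapping.lookup m ` Poly_Mapping.keys m)})
    \<and> (i \<notin> Poly_Mapping.keys m \<longrightarrow> f i = (0::nat))}"
  have "finite ?F"
    by (rule finite_set_of_finite_funs) auto
  moreover have "Poly_Mapping.lookup ` {a. \<exists>b. a + b = m} \<subseteq> ?F"
  proof (safe, goal_cases)
    case (1 _ a b i)
    then have "Poly_Mapping.lookup a i \<le> Poly_Mapping.lookup (a + b) i" by (simp add: lookup_add)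
    also have "\<dots> \<le> Max (Poly_Mapping.lookup (a + b) ` Poly_Mapping.keys (a + b))"
      using 1 by (intro Max_ge) auto
    finally show ?case by simp
  next
    case (2 _ a b i)
    then have "Poly_Mapping.lookup (a + b) i = 0" by (simp add: in_keys_iff)
    then show ?case by (simp add: lookup_add)
  qed
  ultimately have "finite (Poly_Mapping.lookup ` {a. \<exists>b. a + b = m})" by (rule rev_finite_subset)
  then show ?thesis
    by (rule finite_imageD) (simp add: inj_on_def poly_mapping_eqI)
qed

lemma finite_exponent_splits [simp]: "finite {(a, b). a + b = (m :: nat \<Rightarrow>\<^sub>0 nat)}"
proof (rule finite_subset)
  show "{(a, b). a + b = m} \<subseteq> {a. \<exists>b. a + b = m} \<times> {a. \<exists>b. a + b = m}"
    by (auto intro: add.commute)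
qed (simp add: finite_le_exponent)

instantiation mfps :: (comm_ring_1) comm_ring_1
begin

lift_definition zero_mfps :: "'a mfps" is "\<lambda>_. 0" .
lift_definition one_mfps :: "'a mfps" is "\<lambda>m. if m = 0 then 1 else 0" .
lift_definition plus_mfps :: "'a mfps \<Rightarrow> 'a mfps \<Rightarrow> 'a mfps" is "\<lambda>f g m. f m + g m" .
lift_definition minus_mfps :: "'a mfps \<Rightarrow> 'a mfps \<Rightarrow> 'a mfps" is "\<lambda>f g m. f m - g m" .
lift_definition uminus_mfps :: "'a mfps \<Rightarrow> 'a mfps" is "\<lambda>f m. - f m" .
lift_definition times_mfps :: "'a mfps \<Rightarrow> 'a mfps \<Rightarrow> 'a mfps"
  is "\<lambda>f g m. \<Sum>(a, b)\<in>{(a, b). a + b = m}. f a * g b" .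

instance
proof
  fix f g h :: "'a mfps"
  show "f + g + h = f + (g + h)" "f + g = g + f" "0 + f = f" "- f + f = 0" "f - g = f + - g"
    by (transfer; simp add: fun_eq_iff algebra_simps)+
  show "(0::'a mfps) \<noteq> 1" by transfer (metis zero_neq_one)
  show "f * g = g * f"
    by transfer
      (rule ext, rule sum.reindex_bij_witness[of _ prod.swap prod.swap]; auto simp: ac_simps)
  show "1 * f = f"
  proof (transfer, rule ext)
    fix f :: "(nat \<Rightarrow>\<^sub>0 nat) \<Rightarrow> 'a" and m :: "nat \<Rightarrow>\<^sub>0 nat"
    have "(\<Sum>(a, b)\<in>{(a, b). a + b = m}. (if a = 0 then 1 else 0) * f b)
        = (\<Sum>(a, b)\<in>{(0 :: nat \<Rightarrow>\<^sub>0 nat, m)}. (if a = 0 then 1 else 0) * f b)"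
      by (rule sum.mono_neutral_right) (auto split: if_splits)
    then show "(\<Sum>(a, b)\<in>{(a, b). a + b = m}. (if a = 0 then 1 else 0) * f b) = f m"
      by simp
  qed
  show "(f + g) * h = f * h + g * h"
    by transfer (simp add: fun_eq_iff sum.distrib[symmetric] case_prod_beta algebra_simps)
  show "f * g * h = f * (g * h)"
  proof (transfer, rule ext)
    fix f g h :: "(nat \<Rightarrow>\<^sub>0 nat) \<Rightarrow> 'a" and m
    let ?P = "\<lambda>m. {(a :: nat \<Rightarrow>\<^sub>0 nat, b). a + b = m}"
    have "(\<Sum>(a, b)\<in>?P m. (\<Sum>(c, d)\<in>?P a. f c * g d) * h b)
        = (\<Sum>p\<in>?P m. \<Sum>q\<in>?P (fst p). f (fst q) * g (snd q) * h (snd p))"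
      by (simp add: case_prod_beta sum_distrib_right)
    also have "\<dots> = (\<Sum>(p, q)\<in>(SIGMA p:?P m. ?P (fst p)). f (fst q) * g (snd q) * h (snd p))"
      by (rule sum.Sigma) auto
    also have "\<dots> = (\<Sum>(p, q)\<in>(SIGMA p:?P m. ?P (snd p)). f (fst p) * (g (fst q) * h (snd q)))"
      by (rule sum.reindex_bij_witness
          [where i = "\<lambda>((a, _), (c, d)). ((a + c, d), (a, c))"
             and j = "\<lambda>((_, b), (c, d)). ((c, d + b), (d, b))"])
        (auto simp: ac_simps)
    also have "\<dots> = (\<Sum>p\<in>?P m. \<Sum>q\<in>?P (snd p). f (fst p) * (g (fst q) * h (snd q)))"
      by (rule sum.Sigma[symmetric]) auto
    also have "\<dots> = (\<Sum>(a, b)\<in>?P m. f a * (\<Sum>(c, d)\<in>?P b. g c * h d))"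
      by (simp add: case_prod_beta sum_distrib_left)
    finally show "(\<Sum>(a, b)\<in>?P m. (\<Sum>(c, d)\<in>?P a. f c * g d) * h b)
        = (\<Sum>(a, b)\<in>?P m. f a * (\<Sum>(c, d)\<in>?P b. g c * h d))" .
  qed
qed

end

text \<open>Quotients are meaningful when the denominator is a unit of the power series ring.\<close>

instantiation mfps :: (comm_ring_1) inverse
begin

definition inverse_mfps :: "'a mfps \<Rightarrow> 'a mfps" where
  "inverse_mfps f = (if f dvd 1 then (THE g. f * g = 1) else 0)"

definition divide_mfps :: "'a mfps \<Rightarrow> 'a mfps \<Rightarrow> 'a mfps" where
  "divide_mfps f g = f * inverse g"

instance ..

end

lemma mfps_inverse_right:
  fixes f :: "'a::comm_ring_1 mfps"
  assumes "f dvd 1"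
  shows "f * inverse f = 1"
proof -
  obtain g where g: "f * g = 1" using assms by (metis dvdE)
  have "h = g" if "f * h = 1" for h
    using that g by (metis mult.assoc mult.commute mult_1)
  with g have "(THE g. f * g = 1) = g" by (rule the_equality)
  with assms g show ?thesis by (simp add: inverse_mfps_def)
qed

definition mfps_X :: "nat \<Rightarrow> 'a::comm_ring_1 mfps" where
  "mfps_X i = Abs_mfps (\<lambda>m. if m = Poly_Mapping.single i 1 then 1 else 0)"

text \<open>
  A path is represented by the list \<open>[z\<^sub>0, z\<^sub>1, \<dots>]\<close> of the heights of its lattice points; the
  horizontal coordinates are the list positions.
\<close>

definition augmented_catalan_path :: "nat \<Rightarrow> nat \<Rightarrow> int list \<Rightarrow> bool" where
  "augmented_catalan_path k n z \<longleftrightarrow>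
     length z = k * n + 2 \<and>
     z ! 0 = 0 \<and>
     (\<forall>i\<in>{1..k * n + 1}. z ! i - z ! (i - 1) \<in> {1, 1 - int k}) \<and>
     card {i\<in>{1..k * n + 1}. z ! i - z ! (i - 1) = 1} = (k - 1) * n + 1 \<and>
     card {i\<in>{1..k * n + 1}. z ! i - z ! (i - 1) = 1 - int k} = n \<and>
     z ! 1 - z ! 0 = 1 \<and>
     (\<forall>i\<in>{1..k * n + 1}. z ! i \<ge> 1)"

text \<open>
  The vector \<open>(i\<^sub>1, \<dots>, i\<^sub>r)\<close> is given by an exponent vector \<open>m\<close>
  with \<open>i\<^sub>j = Poly_Mapping.lookup m j\<close>.
\<close>

definition has_path_type :: "nat \<Rightarrow> int list \<Rightarrow> (nat \<Rightarrow>\<^sub>0 nat) \<Rightarrow> bool" where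
  "has_path_type r z m \<longleftrightarrow>
     (\<forall>j\<in>{1..r}. card {i\<in>{1..<length z}. z ! i = int j} = Poly_Mapping.lookup m j) \<and>
     (\<forall>i\<in>{1..<length z}. z ! i \<le> int r)"

definition catalan_type_number :: "nat \<Rightarrow> nat \<Rightarrow> (nat \<Rightarrow>\<^sub>0 nat) \<Rightarrow> nat" where
  "catalan_type_number k r m =
     card {z. (\<exists>n. augmented_catalan_path k n z) \<and> has_path_type r z m}"

definition catalan_type_series :: "nat \<Rightarrow> nat \<Rightarrow> int mfps" where
  "catalan_type_series k r =
     Abs_mfps (\<lambda>m. if Poly_Mapping.keys m \<subseteq> {1..r} \<and> Poly_Mapping.lookup m 1 \<ge> 1
                   then int (catalan_type_number k r m) else 0)"

definition disjoint_union_of_runs :: "nat \<Rightarrow> nat set \<Rightarrow> bool" where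
  "disjoint_union_of_runs k S \<longleftrightarrow>
     (\<exists>B. disjoint B \<and> (\<forall>A\<in>B. \<exists>c. A = {c..<c + k}) \<and> S = \<Union>B)"

definition catalan_denominator :: "nat \<Rightarrow> nat \<Rightarrow> nat \<Rightarrow> int mfps" where
  "catalan_denominator k a b =
     (\<Sum>S | S \<subseteq> {a..b} \<and> disjoint_union_of_runs k S.
        (- 1) ^ (card S div k) * (\<Prod>i\<in>S. mfps_X i))"

end

theory Submission
  imports Defs
begin

text \<open>
  Fix \<open>r\<close> and let \<open>G\<^sub>j\<close> enumerate, by visited levels, the walks from level 1 to level \<open>j\<close> that stay
  in \<open>{1..r}\<close> and use the steps \<open>+1\<close> and \<open>1 - k\<close>. Removing the last point gives
  \<open>G\<^sub>j = [j = 1] x\<^sub>1 + x\<^sub>j (G\<^bsub>j-1\<^esub> + G\<^bsub>j-1+k\<^esub>)\<close>. Splitting the sets \<open>S\<close> according to whether they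
  contain \<open>j\<close> gives \<open>Q(x\<^sub>j, \<dots>) = Q(x\<^bsub>j+1\<^esub>, \<dots>) - x\<^sub>j \<cdots> x\<^bsub>j+k-1\<^esub> Q(x\<^bsub>j+k\<^esub>, \<dots>)\<close>, so that
  \<open>x\<^sub>1 \<cdots> x\<^sub>j Q(x\<^bsub>j+1\<^esub>, \<dots>, x\<^sub>r) / Q(x\<^sub>1, \<dots>, x\<^sub>r)\<close> solves the same linear system. The solution is
  unique because multiplication by \<open>x\<^sub>j\<close> raises the degree; the theorem is the case \<open>j = 1\<close>.
\<close>

section \<open>Multivariate power series\<close>

text \<open>The total degree. It bounds how many powers of a series without constant term reach a
  given coefficient, and it is the induction measure for uniqueness.\<close>

definition exponent_degree :: "(nat \<Rightarrow>\<^sub>0 nat) \<Rightarrow> nat" where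
  "exponent_degree m = (\<Sum>i\<in>Poly_Mapping.keys m. Poly_Mapping.lookup m i)"

lemma exponent_degree_superset:
  assumes "finite A" and "Poly_Mapping.keys m \<subseteq> A"
  shows "exponent_degree m = (\<Sum>i\<in>A. Poly_Mapping.lookup m i)"
  unfolding exponent_degree_def using assms
  by (intro sum.mono_neutral_left) (auto simp: in_keys_iff)

lemma exponent_degree_add: "exponent_degree (a + b) = exponent_degree a + exponent_degree b"
proof -
  let ?A = "Poly_Mapping.keys a \<union> Poly_Mapping.keys b"
  have "exponent_degree (a + b) = (\<Sum>i\<in>?A. Poly_Mapping.lookup (a + b) i)"
    by (rule exponent_degree_superset) (use Poly_Mapping.keys_add[of a b] in auto)
  also have "\<dots> = (\<Sum>i\<in>?A. Poly_Mapping.lookup a i) + (\<Sum>i\<in>?A. Poly_Mapping.lookup b i)"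
    by (simp add: lookup_add sum.distrib)
  also have "\<dots> = exponent_degree a + exponent_degree b"
    by (simp add: exponent_degree_superset[of ?A])
  finally show ?thesis .
qed

lemma exponent_degree_zero [simp]: "exponent_degree 0 = 0"
  by (simp add: exponent_degree_def)

lemma exponent_degree_single [simp]: "exponent_degree (Poly_Mapping.single i n) = n"
  by (simp add: exponent_degree_def)

lemma exponent_degree_pos: "m \<noteq> 0 \<Longrightarrow> exponent_degree m > 0"
  unfolding exponent_degree_def by (rule sum_pos) (auto simp: in_keys_iff)

lemma mcoeff_sum: "mcoeff (\<Sum>i\<in>A. f i) m = (\<Sum>i\<in>A. mcoeff (f i) m)"
  by (induction A rule: infinite_finite_induct) (auto simp: zero_mfps.rep_eq plus_mfps.rep_eq)

lemma mcoeff_mult_zero [simp]: "mcoeff (f * g) 0 = mcoeff f 0 * mcoeff g 0"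
proof -
  have "a + b = 0 \<longleftrightarrow> a = 0 \<and> b = 0" for a b :: "nat \<Rightarrow>\<^sub>0 nat"
    using exponent_degree_add[of a b] exponent_degree_pos[of a] exponent_degree_pos[of b] by fastforce
  then have "{(a, b). a + b = (0 :: nat \<Rightarrow>\<^sub>0 nat)} = {(0, 0)}" by (simp add: set_eq_iff)
  then show ?thesis by (simp add: times_mfps.rep_eq)
qed

text \<open>Every monomial of \<open>h\<close> has degree at least 1, so \<open>h ^ n\<close> starts
  in degree \<open>n\<close>. In a split \<open>a + b = m\<close>, either \<open>a = 0\<close> kills
  the first factor or \<open>b\<close> has smaller degree.\<close>

lemma mcoeff_power_eq_0:
  assumes "mcoeff h 0 = 0" and "exponent_degree m < n"
  shows "mcoeff (h ^ n) m = 0"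
  using assms(2)
proof (induction n arbitrary: m)
  case (Suc n)
  have "mcoeff h a * mcoeff (h ^ n) b = 0" if "a + b = m" for a b
  proof (cases "a = 0")
    case False
    then have "exponent_degree b < n"
      using Suc.prems exponent_degree_pos[of a] exponent_degree_add[of a b] that by simp
    then show ?thesis using Suc.IH by simp
  qed (use assms(1) in simp)
  then show ?case by (auto simp: times_mfps.rep_eq intro!: sum.neutral)
qed simp

text \<open>The inverse is the geometric series in \<open>1 - f\<close>.\<close>

lemma mfps_is_unit:
  fixes f :: "'a::comm_ring_1 mfps"
  assumes "mcoeff f 0 = 1"
  shows "f dvd 1"
proof -
  define h where "h = 1 - f"
  have h0: "mcoeff h 0 = 0"
    using assms by (simp add: h_def minus_mfps.rep_eq one_mfps.rep_eq)
  \<comment> \<open>An infinite sum read off coefficientwise: powers of \<open>h\<close> beyond the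
    degree of \<open>m\<close> contribute nothing at \<open>m\<close>, so any longer truncation
    gives the same coefficient.\<close>
  define g where "g = Abs_mfps (\<lambda>m. mcoeff (\<Sum>n\<le>exponent_degree m. h ^ n) m)"
  have g: "mcoeff g m = mcoeff (\<Sum>n\<le>N. h ^ n) m" if "exponent_degree m \<le> N" for m N
  proof -
    have "mcoeff g m = (\<Sum>n\<le>exponent_degree m. mcoeff (h ^ n) m)"
      by (simp add: g_def Abs_mfps_inverse mcoeff_sum)
    also have "\<dots> = (\<Sum>n\<le>N. mcoeff (h ^ n) m)"
      using that by (intro sum.mono_neutral_left) (auto intro!: mcoeff_power_eq_0 h0)
    finally show ?thesis by (simp add: mcoeff_sum)
  qed
  have "f * g = 1"
  proof (rule mfps_eqI)
    fix m
    let ?N = "exponent_degree m"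
    \<comment> \<open>In a split \<open>a + b = m\<close> the degree of \<open>b\<close> is at most
      that of \<open>m\<close>, so one truncation serves all splits and the finite geometric sum
      telescopes.\<close>
    have "mcoeff (f * g) m = mcoeff (f * (\<Sum>n\<le>?N. h ^ n)) m"
      unfolding times_mfps.rep_eq
      by (rule sum.cong) (auto simp: exponent_degree_add intro!: arg_cong2[of _ _ _ _ "(*)"] g)
    also have "f * (\<Sum>n\<le>?N. h ^ n) = 1 - h ^ Suc ?N"
      using one_diff_power_eq[of h "Suc ?N"] by (simp add: h_def lessThan_Suc_atMost del: power_Suc)
    also have "mcoeff \<dots> m = mcoeff 1 m"
      using mcoeff_power_eq_0[OF h0, of m "Suc ?N"] by (simp add: minus_mfps.rep_eq del: power_Suc)
    finally show "mcoeff (f * g) m = mcoeff 1 m" .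
  qed
  then show ?thesis by (metis dvdI)
qed

section \<open>Multiplication by a variable, and uniqueness for linear systems\<close>

lemma mcoeff_X: "mcoeff (mfps_X i) m = (if m = Poly_Mapping.single i 1 then 1 else 0)"
  by (simp add: mfps_X_def Abs_mfps_inverse)

lemma mcoeff_X_zero [simp]: "mcoeff (mfps_X i) 0 = 0"
  by (metis mcoeff_X exponent_degree_single exponent_degree_zero zero_neq_one)

lemma mcoeff_X_mult_add: "mcoeff (mfps_X i * f) (m + Poly_Mapping.single i 1) = mcoeff f m"
proof -
  let ?s = "Poly_Mapping.single i (1::nat)"
  have "mcoeff (mfps_X i * f) (m + ?s) = (\<Sum>(a, b)\<in>{(?s, m)}. mcoeff (mfps_X i) a * mcoeff f b)"
    unfolding times_mfps.rep_eq
    by (rule sum.mono_neutral_right) (auto simp: mcoeff_X add.commute split: if_splits)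
  then show ?thesis by (simp add: mcoeff_X)
qed

lemma mcoeff_X_mult_eq_0:
  assumes "Poly_Mapping.lookup m i = 0"
  shows "mcoeff (mfps_X i * f) m = 0"
  unfolding times_mfps.rep_eq
  using assms by (intro sum.neutral) (auto simp: mcoeff_X lookup_add)

text \<open>Either the monomial lacks the variable or the variable can be divided out; the two
  preceding lemmas compute a coefficient of \<open>mfps_X i * f\<close> in these two cases.\<close>

lemma exponent_cases:
  obtains (absent) "Poly_Mapping.lookup m i = 0"
  | (present) m' where "m = m' + Poly_Mapping.single i (1::nat)"
proof (cases "Poly_Mapping.lookup m i = 0")
  case False
  then have "m = (m - Poly_Mapping.single i 1) + Poly_Mapping.single i 1"
    by (intro poly_mapping_eqI) (auto simp: lookup_add lookup_minus lookup_single when_def)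
  then show ?thesis using present by blast
qed (use absent in blast)

text \<open>A coefficient of \<open>H j\<close> at \<open>m\<close> is a sum of coefficients of
  \<open>H a\<close> and \<open>H b\<close> at an exponent of smaller degree, so induction on the
  degree treats all indices at once. The alternative \<open>H j = 0\<close> covers levels outside
  the strip.\<close>

lemma homogeneous_transfer_system_trivial:
  fixes H :: "nat \<Rightarrow> 'a::comm_ring_1 mfps"
  assumes "\<And>j. H j = 0 \<or> (\<exists>a b. H j = mfps_X j * (H a + H b))"
  shows "H j = 0"
proof (rule mfps_eqI)
  fix m
  show "mcoeff (H j) m = mcoeff 0 m"
  proof (induction "exponent_degree m" arbitrary: m j rule: less_induct)
    case less
    show ?case
    proof (cases "H j = 0")
      case False
      then obtain a b where j: "H j = mfps_X j * (H a + H b)" using assms by blast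
      show ?thesis
      proof (cases m j rule: exponent_cases)
        case absent
        then show ?thesis by (simp add: j mcoeff_X_mult_eq_0 zero_mfps.rep_eq)
      next
        case (present m')
        then have "exponent_degree m' < exponent_degree m" by (simp add: exponent_degree_add)
        then have "mcoeff (H a) m' = 0" "mcoeff (H b) m' = 0"
          using less by (auto simp: zero_mfps.rep_eq)
        then show ?thesis
          by (simp only: j present mcoeff_X_mult_add plus_mfps.rep_eq zero_mfps.rep_eq) simp
      qed
    qed simp
  qed
qed

section \<open>The denominator polynomials\<close>

lemma catalan_denominator_empty_interval:
  assumes "b < a"
  shows "catalan_denominator k a b = 1"
proof -
  have "disjoint_union_of_runs k {}"
    unfolding disjoint_union_of_runs_def by (rule exI[of _ "{}"]) auto
  then have "{S. S \<subseteq> {a..b} \<and> disjoint_union_of_runs k S} = {{}}" using assms by auto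
  then show ?thesis by (simp add: catalan_denominator_def)
qed

text \<open>The run containing \<open>a\<close> starts inside \<open>S\<close>, hence not before
  \<open>a\<close>, so it is \<open>{a..<a + k}\<close>. The other runs avoid it and therefore lie
  beyond it.\<close>

lemma disjoint_union_of_runs_remove_first:
  assumes "k > 0" and S: "S \<subseteq> {a..b}" "disjoint_union_of_runs k S" and "a \<in> S"
  shows "a + k \<le> Suc b"
    and "\<exists>S'. S = {a..<a + k} \<union> S' \<and> S' \<subseteq> {a + k..b} \<and> disjoint_union_of_runs k S'"
proof -
  obtain B where B: "disjoint B" "\<forall>A\<in>B. \<exists>c. A = {c..<c + k}" "S = \<Union>B"
    using S(2) unfolding disjoint_union_of_runs_def by blast
  then obtain A where A: "A \<in> B" "a \<in> A" using \<open>a \<in> S\<close> by blast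
  then obtain c where c: "A = {c..<c + k}" using B by blast
  have "c \<in> S" using A B c \<open>k > 0\<close> by auto
  then have "c = a" using S(1) A c by auto
  with c have Aa: "A = {a..<a + k}" by simp
  have "a + k - 1 \<in> A" using Aa \<open>k > 0\<close> by simp
  then have "a + k - 1 \<in> {a..b}" using A(1) B(3) S(1) by blast
  then show "a + k \<le> Suc b" by auto
  let ?S' = "\<Union>(B - {A})"
  have "disjoint_union_of_runs k ?S'"
    unfolding disjoint_union_of_runs_def
    by (rule exI[of _ "B - {A}"]) (use B in \<open>auto simp: disjoint_def\<close>)
  moreover have "?S' \<subseteq> {a + k..b}"
  proof
    fix x assume "x \<in> ?S'"
    then obtain A' where A': "A' \<in> B" "A' \<noteq> A" "x \<in> A'" by blast
    then have "x \<notin> A" using B(1) A(1) by (auto simp: disjoint_def)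
    moreover have "x \<in> {a..b}" using A' B(3) S(1) by blast
    ultimately show "x \<in> {a + k..b}" using Aa by auto
  qed
  moreover have "S = {a..<a + k} \<union> ?S'" using A(1) B(3) Aa by blast
  ultimately show "\<exists>S'. S = {a..<a + k} \<union> S' \<and> S' \<subseteq> {a + k..b} \<and> disjoint_union_of_runs k S'"
    by blast
qed

lemma disjoint_union_of_runs_insert_first:
  assumes "S \<subseteq> {a + k..b}" and "disjoint_union_of_runs k S"
  shows "disjoint_union_of_runs k ({a..<a + k} \<union> S)"
proof -
  obtain B where B: "disjoint B" "\<forall>A\<in>B. \<exists>c. A = {c..<c + k}" "S = \<Union>B"
    using assms(2) unfolding disjoint_union_of_runs_def by blast
  have "{a..<a + k} \<inter> A = {}" if "A \<in> B" for A
  proof -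
    have "A \<subseteq> {a + k..b}" using that B(3) assms(1) by blast
    then show ?thesis by force
  qed
  then have "disjoint (insert {a..<a + k} B)"
    using B(1) by (auto simp: disjoint_def)
  then show ?thesis
    unfolding disjoint_union_of_runs_def
    by (intro exI[of _ "insert {a..<a + k} B"]) (use B in auto)
qed

text \<open>The guard says that the run starting at \<open>a\<close> fits into the interval. When it
  does not, the denominator of the empty interval from \<open>a + k\<close> is still 1, so an
  unguarded formula would subtract a spurious product.\<close>

lemma catalan_denominator_rec:
  assumes "k > 0"
  shows "catalan_denominator k a b = catalan_denominator k (Suc a) b -
    (if a + k \<le> Suc b then (\<Prod>i\<in>{a..<a + k}. mfps_X i) * catalan_denominator k (a + k) b else 0)"
proof -
  let ?R = "\<lambda>a. {S. S \<subseteq> {a..b} \<and> disjoint_union_of_runs k S}"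
  let ?w = "\<lambda>S. (- 1) ^ (card S div k) * (\<Prod>i\<in>S. mfps_X i) :: int mfps"
  let ?f = "\<lambda>S. {a..<a + k} \<union> S"
  let ?A = "if a + k \<le> Suc b then ?f ` ?R (a + k) else {}"
  have fin: "finite (?R a)" for a
    by (rule finite_subset[of _ "Pow {a..b}"]) auto
  have "?R a = ?R (Suc a) \<union> ?A"
  proof (intro equalityI subsetI)
    fix S assume S: "S \<in> ?R a"
    show "S \<in> ?R (Suc a) \<union> ?A"
    proof (cases "a \<in> S")
      case True
      then show ?thesis
        using disjoint_union_of_runs_remove_first[OF assms, of S a b] S by auto
    next
      case False
      have "x \<in> {Suc a..b}" if "x \<in> S" for x
      proof -
        have "x \<in> {a..b}" "x \<noteq> a" using that S False by auto
        then show ?thesis by auto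
      qed
      then show ?thesis using S by blast
    qed
  next
    fix S assume "S \<in> ?R (Suc a) \<union> ?A"
    then consider "S \<in> ?R (Suc a)"
      | S' where "a + k \<le> Suc b" "S' \<in> ?R (a + k)" "S = ?f S'"
      by (auto split: if_splits)
    then show "S \<in> ?R a"
    proof cases
      case 1
      then show ?thesis by force
    next
      case 2
      have "{a..<a + k} \<subseteq> {a..b}" using 2 by auto
      moreover have "S' \<subseteq> {a..b}" using 2(2) by force
      ultimately show ?thesis using 2 disjoint_union_of_runs_insert_first[of S' a k b] by auto
    qed
  qed
  moreover have "?R (Suc a) \<inter> ?A = {}"
  proof -
    have "a \<in> S" if "S \<in> ?A" for S using that assms by (auto split: if_splits)
    moreover have "a \<notin> S" if "S \<in> ?R (Suc a)" for S using that by force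
    ultimately show ?thesis by blast
  qed
  ultimately have "catalan_denominator k a b = catalan_denominator k (Suc a) b + sum ?w ?A"
    unfolding catalan_denominator_def using fin
    by (subst sum.union_disjoint[symmetric]) auto
  moreover have "sum ?w (?f ` ?R (a + k)) =
      - ((\<Prod>i\<in>{a..<a + k}. mfps_X i) * catalan_denominator k (a + k) b)"
  proof -
    have disj: "{a..<a + k} \<inter> S = {}" if "S \<in> ?R (a + k)" for S
    proof -
      have "S \<subseteq> {a + k..b}" using that by simp
      then show ?thesis by force
    qed
    have "inj_on ?f (?R (a + k))"
    proof (rule inj_onI)
      fix S T assume "S \<in> ?R (a + k)" "T \<in> ?R (a + k)" "?f S = ?f T"
      then show "S = T" using disj[of S] disj[of T] by blast
    qed
    then have "sum ?w (?f ` ?R (a + k)) = (\<Sum>S\<in>?R (a + k). ?w (?f S))"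
      by (simp add: sum.reindex)
    also have "\<dots> = (\<Sum>S\<in>?R (a + k). - ((\<Prod>i\<in>{a..<a + k}. mfps_X i) * ?w S))"
    proof (rule sum.cong)
      fix S assume S: "S \<in> ?R (a + k)"
      then have "finite S" using finite_subset by blast
      then have "card (?f S) = k + card S" "(\<Prod>i\<in>?f S. mfps_X i :: int mfps) =
          (\<Prod>i\<in>{a..<a + k}. mfps_X i) * (\<Prod>i\<in>S. mfps_X i)"
        using disj[OF S] by (simp_all add: card_Un_disjoint prod.union_disjoint)
      \<comment> \<open>One more run flips the sign.\<close>
      moreover have "(k + card S) div k = Suc (card S div k)"
        using assms by (simp add: div_add_self1)
      ultimately show "?w (?f S) = - ((\<Prod>i\<in>{a..<a + k}. mfps_X i) * ?w S)"
        by (simp add: algebra_simps)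
    qed simp
    also have "\<dots> = - ((\<Prod>i\<in>{a..<a + k}. mfps_X i) * catalan_denominator k (a + k) b)"
      by (simp add: catalan_denominator_def sum_negf sum_distrib_left)
    finally show ?thesis .
  qed
  ultimately show ?thesis by simp
qed

text \<open>The product subtracted in the recursion contains the factor \<open>mfps_X a\<close>, so
  only the empty set reaches the constant term. This makes the denominator a unit.\<close>

lemma mcoeff_catalan_denominator_zero:
  assumes "k > 0"
  shows "mcoeff (catalan_denominator k a b) 0 = 1"
proof (induction "Suc b - a" arbitrary: a rule: less_induct)
  case less
  show ?case
  proof (cases "b < a")
    case True
    then show ?thesis by (simp add: catalan_denominator_empty_interval one_mfps.rep_eq)
  next
    case False
    then have "mcoeff (catalan_denominator k (Suc a) b) 0 = 1" using less by simp
    moreover have "(\<Prod>i\<in>{a..<a + k}. mfps_X i) = mfps_X a * (\<Prod>i\<in>{Suc a..<a + k}. mfps_X i :: int mfps)"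
      using assms by (simp add: prod.atLeast_Suc_lessThan)
    ultimately show ?thesis
      by (subst catalan_denominator_rec[OF assms]) (simp add: minus_mfps.rep_eq zero_mfps.rep_eq)
  qed
qed

section \<open>Walks in a strip\<close>

text \<open>A path without its starting point at height 0, hence the first entry 1. The end level
  \<open>j\<close> is left free because deleting the last point changes it.\<close>

definition strip_walks :: "nat \<Rightarrow> nat \<Rightarrow> nat \<Rightarrow> int list set" where
  "strip_walks k r j = {y. y \<noteq> [] \<and> hd y = 1 \<and> last y = int j \<and> set y \<subseteq> {1..int r} \<and>
     successively (\<lambda>a b. b - a \<in> {1, 1 - int k}) y}"

definition walk_content :: "int list \<Rightarrow> (nat \<Rightarrow>\<^sub>0 nat)" where
  "walk_content y = (\<Sum>a\<leftarrow>y. Poly_Mapping.single (nat a) 1)"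

definition walk_series :: "nat \<Rightarrow> nat \<Rightarrow> nat \<Rightarrow> int mfps" where
  "walk_series k r j = Abs_mfps (\<lambda>m. int (card {y \<in> strip_walks k r j. walk_content y = m}))"

lemma mcoeff_walk_series:
  "mcoeff (walk_series k r j) m = int (card {y \<in> strip_walks k r j. walk_content y = m})"
  by (simp add: walk_series_def Abs_mfps_inverse)

lemma walk_content_snoc:
  "walk_content (y @ [a]) = walk_content y + Poly_Mapping.single (nat a) 1"
  by (simp add: walk_content_def)

lemma exponent_degree_walk_content: "exponent_degree (walk_content y) = length y"
  by (induction y) (auto simp: walk_content_def exponent_degree_add)

text \<open>\<open>nat\<close> sends every negative height to 0, hence the restriction to
  nonnegative entries.\<close>

lemma lookup_walk_content:
  assumes "set y \<subseteq> {0..}"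
  shows "Poly_Mapping.lookup (walk_content y) i = count_list y (int i)"
  using assms
  by (induction y) (auto simp: walk_content_def lookup_add lookup_single when_def)

text \<open>The content determines the length, and the heights come from a finite set. So the
  \<open>card\<close> in \<open>walk_series\<close> is a genuine count and not the default
  0.\<close>

lemma finite_walks_of_content: "finite {y \<in> strip_walks k r j. walk_content y = m}"
proof (rule finite_subset)
  show "{y \<in> strip_walks k r j. walk_content y = m} \<subseteq>
      {y. set y \<subseteq> {1..int r} \<and> length y = exponent_degree m}"
    by (auto simp: strip_walks_def exponent_degree_walk_content)
qed (rule finite_lists_length_eq, simp)

text \<open>The boundary values of the recursion, which refers to level 0 and to levels above
  \<open>r\<close>.\<close>

lemma walk_series_outside:
  assumes "j = 0 \<or> j > r"
  shows "walk_series k r j = 0"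
proof (rule mfps_eqI)
  have "int j \<notin> {1..int r}" using assms by auto
  then have "strip_walks k r j = {}"
    unfolding strip_walks_def using last_in_set by fastforce
  then show "mcoeff (walk_series k r j) m = mcoeff 0 m" for m
    by (simp add: mcoeff_walk_series zero_mfps.rep_eq)
qed

lemma strip_walks_rec:
  assumes "1 \<le> j" and "j \<le> r"
  shows "strip_walks k r j = (if j = 1 then {[1]} else {}) \<union>
    (\<lambda>y. y @ [int j]) ` (strip_walks k r (j - 1) \<union> strip_walks k r (j - 1 + k))"
proof (intro equalityI subsetI)
  fix y assume y: "y \<in> strip_walks k r j"
  then have "y \<noteq> []" "last y = int j" by (simp_all add: strip_walks_def)
  then obtain y' where y': "y = y' @ [int j]" by (metis append_butlast_last_id)
  show "y \<in> (if j = 1 then {[1]} else {}) \<union>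
    (\<lambda>y. y @ [int j]) ` (strip_walks k r (j - 1) \<union> strip_walks k r (j - 1 + k))"
  proof (cases "y' = []")
    case True
    then show ?thesis using y y' by (auto simp: strip_walks_def)
  next
    case False
    then have "int j - last y' = 1 \<or> int j - last y' = 1 - int k"
      using y y' by (auto simp: strip_walks_def successively_append_iff)
    then have "last y' = int (j - 1) \<or> last y' = int (j - 1 + k)"
      using assms by (auto simp: of_nat_diff)
    then have "y' \<in> strip_walks k r (j - 1) \<union> strip_walks k r (j - 1 + k)"
      using y y' False by (auto simp: strip_walks_def successively_append_iff)
    then show ?thesis using y' by auto
  qed
next
  fix y assume "y \<in> (if j = 1 then {[1]} else {}) \<union>
    (\<lambda>y. y @ [int j]) ` (strip_walks k r (j - 1) \<union> strip_walks k r (j - 1 + k))"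
  then consider "j = 1" "y = [1]"
    | y' where "y = y' @ [int j]" "y' \<in> strip_walks k r (j - 1) \<union> strip_walks k r (j - 1 + k)"
    by (auto split: if_splits)
  then show "y \<in> strip_walks k r j"
  proof cases
    case 1
    then show ?thesis using assms by (auto simp: strip_walks_def)
  next
    case 2
    then show ?thesis
      using assms by (auto simp: strip_walks_def successively_append_iff of_nat_diff)
  qed
qed

lemma walk_series_rec:
  assumes "1 \<le> j" and "j \<le> r" and "k > 0"
  shows "walk_series k r j = (if j = 1 then mfps_X 1 else 0) +
    mfps_X j * (walk_series k r (j - 1) + walk_series k r (j - 1 + k))"
proof (rule mfps_eqI)
  fix m :: "nat \<Rightarrow>\<^sub>0 nat"
  let ?W = "\<lambda>j m. {y \<in> strip_walks k r j. walk_content y = m}"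
  let ?I = "if j = 1 \<and> m = Poly_Mapping.single 1 1 then {[1::int]} else {}"
  let ?J = "{y \<in> strip_walks k r (j - 1) \<union> strip_walks k r (j - 1 + k).
              walk_content (y @ [int j]) = m}"
  have c1: "walk_content [1] = Poly_Mapping.single 1 1" by (simp add: walk_content_def)
  have W: "?W j m = ?I \<union> (\<lambda>y. y @ [int j]) ` ?J"
    unfolding strip_walks_rec[OF assms(1,2)] by (auto simp: c1 split: if_splits)
  have fin: "finite ((\<lambda>y. y @ [int j]) ` ?J)"
    by (rule finite_subset[OF _ finite_walks_of_content[of k r j m]]) (use W in blast)
  \<comment> \<open>Walks are nonempty, so an extended walk has at least two points and differs from
    the one-point walk.\<close>
  have "[] \<notin> strip_walks k r i" for i by (simp add: strip_walks_def)
  then have "?I \<inter> (\<lambda>y. y @ [int j]) ` ?J = {}" by auto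
  then have "card (?W j m) = card ?I + card ((\<lambda>y. y @ [int j]) ` ?J)"
    unfolding W using fin by (intro card_Un_disjoint) auto
  then have W': "card (?W j m) = card ?I + card ?J"
    by (simp add: card_image inj_on_def)
  have I: "int (card ?I) = mcoeff (if j = 1 then mfps_X 1 else 0) m"
    by (simp add: mcoeff_X zero_mfps.rep_eq)
  have J: "int (card ?J) = mcoeff (mfps_X j * (walk_series k r (j - 1) + walk_series k r (j - 1 + k))) m"
  proof (cases m j rule: exponent_cases)
    case absent
    have "?J = {}" using absent by (auto simp: walk_content_snoc lookup_add)
    then show ?thesis using absent by (simp only: mcoeff_X_mult_eq_0) simp
  next
    case (present m')
    have "?J = ?W (j - 1) m' \<union> ?W (j - 1 + k) m'"
      by (auto simp: walk_content_snoc present)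
    \<comment> \<open>As \<open>k > 0\<close>, the two predecessor levels differ, and so do walks
      ending there.\<close>
    moreover have "?W (j - 1) m' \<inter> ?W (j - 1 + k) m' = {}"
      using assms(3) by (auto simp: strip_walks_def)
    ultimately have "card ?J = card (?W (j - 1) m') + card (?W (j - 1 + k) m')"
      by (simp add: card_Un_disjoint finite_walks_of_content)
    then show ?thesis
      by (simp only: present mcoeff_X_mult_add plus_mfps.rep_eq mcoeff_walk_series of_nat_add)
  qed
  show "mcoeff (walk_series k r j) m = mcoeff ((if j = 1 then mfps_X 1 else 0) +
    mfps_X j * (walk_series k r (j - 1) + walk_series k r (j - 1 + k))) m"
    unfolding mcoeff_walk_series plus_mfps.rep_eq[of "if j = 1 then mfps_X 1 else 0"]
    using W' I J by simp
qed

text \<open>With the denominator cleared, both sides satisfy the same inhomogeneous recursion in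
  \<open>j\<close>; their difference \<open>H\<close> solves the homogeneous one and
  vanishes.\<close>

lemma walk_series_times_denominator:
  assumes "k \<ge> 2" and "1 \<le> j" and "j \<le> r"
  shows "walk_series k r j * catalan_denominator k 1 r =
    (\<Prod>i\<in>{1..<Suc j}. mfps_X i) * catalan_denominator k (Suc j) r"
proof -
  let ?Q = "\<lambda>a. catalan_denominator k a r"
  let ?P = "\<lambda>j. \<Prod>i\<in>{1..<Suc j}. mfps_X i :: int mfps"
  \<comment> \<open>The claimed solution, cut off to 0 outside the strip so that it has the boundary
    values of the walk series; the bare formula would be nonzero there.\<close>
  let ?E = "\<lambda>j. if 1 \<le> j \<and> j \<le> r then ?P j * ?Q (Suc j) else 0"
  let ?G = "walk_series k r"
  define H where "H j = ?G j * ?Q 1 - ?E j" for j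
  have G: "?G j * ?Q 1 = H j + ?E j" for j by (simp add: H_def)
  have "H j = 0 \<or> (\<exists>a b. H j = mfps_X j * (H a + H b))" for j
  proof (cases "1 \<le> j \<and> j \<le> r")
    case False
    then have "H j = 0" using walk_series_outside[of j r k] by (auto simp: H_def)
    then show ?thesis ..
  next
    case True
    have Pj: "?P j = mfps_X j * ?P (j - 1)"
      using True by (cases j) (auto simp: mult.commute)
    have "{1..<Suc (j - 1 + k)} = {1..<Suc (j - 1)} \<union> {j..<j + k}" using True by auto
    moreover have "{1..<Suc (j - 1)} \<inter> {j..<j + k} = {}" by auto
    ultimately have Pjk: "?P (j - 1 + k) = ?P (j - 1) * (\<Prod>i\<in>{j..<j + k}. mfps_X i)"
      by (simp only: prod.union_disjoint finite_atLeastLessThan)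
    have E: "?E (j - 1 + k) = (if j + k \<le> Suc r
        then ?P (j - 1) * (\<Prod>i\<in>{j..<j + k}. mfps_X i) * ?Q (j + k) else 0)"
    proof -
      have "Suc (j - 1 + k) = j + k" "1 \<le> j - 1 + k" "j - 1 + k \<le> r \<longleftrightarrow> j + k \<le> Suc r"
        using True assms(1) by auto
      then show ?thesis unfolding Pjk[symmetric] by simp
    qed
    \<comment> \<open>The denominator recursion times the first \<open>j - 1\<close> variables. Its
      guard \<open>j + k <= Suc r\<close> is exactly the cut-off of \<open>?E\<close> at level
      \<open>j - 1 + k\<close>.\<close>
    have Q: "?P (j - 1) * ?Q j = ?P (j - 1) * ?Q (Suc j) - ?E (j - 1 + k)"
      unfolding E using assms(1) by (subst catalan_denominator_rec[of k j r]) (auto simp: algebra_simps)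
    have Ej: "?E j = mfps_X j * (?P (j - 1) * ?Q (Suc j))"
      unfolding Pj using True by (simp add: mult.assoc)
    \<comment> \<open>For \<open>j = 1\<close> the value \<open>?E 0\<close> is cut off to 0 and the
      one-point walk supplies the missing \<open>?Q 1\<close>.\<close>
    have start: "(if j = 1 then mfps_X 1 else 0) * ?Q 1 + mfps_X j * ?E (j - 1) =
        mfps_X j * (?P (j - 1) * ?Q j)"
      using True by (cases "j = 1") auto
    have "?G j * ?Q 1 = (if j = 1 then mfps_X 1 else 0) * ?Q 1 +
        mfps_X j * (?G (j - 1) * ?Q 1 + ?G (j - 1 + k) * ?Q 1)"
      using True assms(1) by (subst walk_series_rec) (auto simp: algebra_simps)
    also have "\<dots> = mfps_X j * (H (j - 1) + H (j - 1 + k)) +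
        ((if j = 1 then mfps_X 1 else 0) * ?Q 1 + mfps_X j * ?E (j - 1)) + mfps_X j * ?E (j - 1 + k)"
      unfolding G by (simp only: distrib_left add.assoc add.commute add.left_commute)
    also have "\<dots> = mfps_X j * (H (j - 1) + H (j - 1 + k)) + ?E j"
      unfolding start Q Ej by (simp add: algebra_simps)
    finally have "H j = mfps_X j * (H (j - 1) + H (j - 1 + k))" by (simp add: H_def)
    then show ?thesis by blast
  qed
  then have "H j = 0" by (rule homogeneous_transfer_system_trivial)
  then show ?thesis using assms by (simp add: H_def)
qed

section \<open>Catalan paths as closed walks\<close>

lemma ball_Suc_iff: "(\<forall>i\<in>{1..n}. P i) \<longleftrightarrow> (\<forall>i<n. P (Suc i))"
  unfolding image_Suc_lessThan[symmetric] by blast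

text \<open>The height telescopes over the steps. Since \<open>k > 0\<close>, the two step values
  differ, so the positions split into ups and downs.\<close>

lemma height_eq_ups_downs:
  fixes z :: "int list"
  assumes "k > 0" and "\<forall>i\<in>{1..L}. z ! i - z ! (i - 1) \<in> {1, 1 - int k}"
  shows "z ! L - z ! 0 = int (card {i\<in>{1..L}. z ! i - z ! (i - 1) = 1}) +
      (1 - int k) * int (card {i\<in>{1..L}. z ! i - z ! (i - 1) = 1 - int k})"
    and "card {i\<in>{1..L}. z ! i - z ! (i - 1) = 1} +
      card {i\<in>{1..L}. z ! i - z ! (i - 1) = 1 - int k} = L"
proof -
  let ?U = "{i\<in>{1..L}. z ! i - z ! (i - 1) = 1}"
  let ?D = "{i\<in>{1..L}. z ! i - z ! (i - 1) = 1 - int k}"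
  have UD: "{1..L} = ?U \<union> ?D" "?U \<inter> ?D = {}" using assms by auto
  have fin: "finite ?U" "finite ?D" by auto
  have "z ! L - z ! 0 = (\<Sum>i\<in>{1..L}. z ! i - z ! (i - 1))"
    by (induction L) (auto simp: sum.nat_ivl_Suc')
  also have "\<dots> = (\<Sum>i\<in>?U. z ! i - z ! (i - 1)) + (\<Sum>i\<in>?D. z ! i - z ! (i - 1))"
    by (subst UD(1)) (rule sum.union_disjoint[OF fin UD(2)])
  also have "\<dots> = int (card ?U) + (1 - int k) * int (card ?D)" by simp
  finally show "z ! L - z ! 0 = int (card ?U) + (1 - int k) * int (card ?D)" .
  show "card ?U + card ?D = L"
    unfolding card_Un_disjoint[OF fin UD(2), symmetric] UD(1)[symmetric] by simp
qed

text \<open>By the height balance, ending at height 1 amounts to having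
  \<open>(k - 1) * n + 1\<close> up steps, where \<open>n\<close> is the number of down
  steps.\<close>

lemma augmented_catalan_path_iff:
  assumes "k \<ge> 2"
  shows "(\<exists>n. augmented_catalan_path k n (0 # y)) \<longleftrightarrow>
    y \<noteq> [] \<and> hd y = 1 \<and> last y = 1 \<and> set y \<subseteq> {1..} \<and>
    successively (\<lambda>a b. b - a \<in> {1, 1 - int k}) y"
    (is "?L \<longleftrightarrow> ?R")
proof -
  let ?z = "0 # y"
  let ?U = "card {i\<in>{1..length y}. ?z ! i - ?z ! (i - 1) = 1}"
  let ?D = "card {i\<in>{1..length y}. ?z ! i - ?z ! (i - 1) = 1 - int k}"
  have last: "?z ! length y = last y" if "y \<noteq> []"
    using that by (simp add: last_conv_nth nth_Cons')
  have steps: "(\<forall>i\<in>{1..length y}. ?z ! i - ?z ! (i - 1) \<in> {1, 1 - int k}) \<longleftrightarrow>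
      successively (\<lambda>a b. b - a \<in> {1, 1 - int k}) y" if "hd y = 1" "y \<noteq> []"
  proof -
    have "(\<forall>i\<in>{1..length y}. ?z ! i - ?z ! (i - 1) \<in> {1, 1 - int k}) \<longleftrightarrow>
        (\<forall>i<length y. ?z ! Suc i - ?z ! i \<in> {1, 1 - int k})"
      unfolding ball_Suc_iff by simp
    also have "\<dots> \<longleftrightarrow> successively (\<lambda>a b. b - a \<in> {1, 1 - int k}) ?z"
      by (simp add: successively_conv_nth)
    \<comment> \<open>The step from 0 to \<open>hd y = 1\<close> is an admissible up step.\<close>
    also have "\<dots> \<longleftrightarrow> successively (\<lambda>a b. b - a \<in> {1, 1 - int k}) y"
      using that by (simp add: successively_Cons)
    finally show ?thesis .
  qed
  have levels: "(\<forall>i\<in>{1..length y}. ?z ! i \<ge> 1) \<longleftrightarrow> set y \<subseteq> {1..}"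
  proof -
    have "set y \<subseteq> {1..} \<longleftrightarrow> (\<forall>i<length y. y ! i \<ge> 1)"
      by (auto simp: subset_iff in_set_conv_nth)
    also have "\<dots> \<longleftrightarrow> (\<forall>i\<in>{1..length y}. ?z ! i \<ge> 1)"
      using ball_Suc_iff[of "length y" "\<lambda>i. ?z ! i \<ge> 1"] by simp
    finally show ?thesis ..
  qed
  show ?thesis
  proof
    assume ?L
    then obtain n where n: "augmented_catalan_path k n ?z" ..
    then have len: "k * n + 1 = length y" by (simp add: augmented_catalan_path_def)
    note path = n[unfolded augmented_catalan_path_def len]
    have "y \<noteq> []" using len by auto
    have hd: "hd y = 1" using path \<open>y \<noteq> []\<close> by (simp add: hd_conv_nth)
    have "last y = int ?U + (1 - int k) * int ?D"
      using height_eq_ups_downs(1)[of k "length y" ?z] path assms last[OF \<open>y \<noteq> []\<close>] by simp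
    also have "?U = (k - 1) * n + 1" using path by blast
    also have "?D = n" using path by blast
    also have "int ((k - 1) * n + 1) + (1 - int k) * int n = 1"
      using assms by (simp add: of_nat_diff algebra_simps)
    finally show ?R using path hd \<open>y \<noteq> []\<close> steps levels by simp
  next
    assume R: ?R
    have st: "\<forall>i\<in>{1..length y}. ?z ! i - ?z ! (i - 1) \<in> {1, 1 - int k}"
      using R steps by simp
    have sum: "int ?U + (1 - int k) * int ?D = 1" and len: "?U + ?D = length y"
      using height_eq_ups_downs[of k "length y" ?z] st R last assms by auto
    define n where "n = ?D"
    have U: "?U = (k - 1) * n + 1"
    proof -
      have "int ?U = int ((k - 1) * n + 1)"
        using sum assms by (simp add: n_def algebra_simps)
      then show ?thesis by linarith
    qed
    have "k * n = (k - 1) * n + n" using assms by (cases k) auto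
    then have len': "k * n + 1 = length y" using len U n_def by simp
    have "augmented_catalan_path k n ?z"
      unfolding augmented_catalan_path_def len'
      using R st levels U n_def len' by (auto simp: hd_conv_nth)
    then show ?L ..
  qed
qed

text \<open>Positions start at 1, so the starting height \<open>x\<close> is skipped.\<close>

lemma card_positions_Cons:
  "card {i\<in>{1..<length (x # y)}. (x # y) ! i = a} = count_list y a"
proof -
  have "{i\<in>{1..<length (x # y)}. (x # y) ! i = a} = Suc ` {i. i < length y \<and> y ! i = a}"
    by (auto simp: image_iff nth_Cons' gr0_conv_Suc)
  then have "card {i\<in>{1..<length (x # y)}. (x # y) ! i = a} = card {i. i < length y \<and> y ! i = a}"
    by (simp add: card_image)
  also have "\<dots> = count_list y a"
    by (simp add: count_list_eq_length_filter length_filter_conv_card eq_commute)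
  finally show ?thesis .
qed

text \<open>Prepending the height 0 is a bijection from walks ending at level 1 to paths. Off the
  admissible exponents both coefficients vanish, since every walk visits level 1 and stays in the
  strip.\<close>

lemma catalan_type_series_eq_walk_series:
  assumes "k \<ge> 2"
  shows "catalan_type_series k r = walk_series k r 1"
proof (rule mfps_eqI)
  fix m :: "nat \<Rightarrow>\<^sub>0 nat"
  let ?C = "Poly_Mapping.keys m \<subseteq> {1..r} \<and> Poly_Mapping.lookup m 1 \<ge> 1"
  let ?Z = "{z. (\<exists>n. augmented_catalan_path k n z) \<and> has_path_type r z m}"
  let ?W = "{y \<in> strip_walks k r 1. walk_content y = m}"
  have C: ?C if "y \<in> ?W" for y
  proof -
    have y: "y \<noteq> []" "hd y = 1" "set y \<subseteq> {1..int r}" "walk_content y = m"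
      using that by (auto simp: strip_walks_def)
    then have m: "Poly_Mapping.lookup m i = count_list y (int i)" for i
      using lookup_walk_content[of y i] by force
    have "1 \<in> set y" using y hd_in_set by metis
    then have "Poly_Mapping.lookup m 1 \<noteq> 0" by (simp add: m count_list_0_iff)
    moreover have "i \<in> {1..r}" if "i \<in> Poly_Mapping.keys m" for i
    proof -
      have "int i \<in> set y" using that by (simp add: in_keys_iff m count_list_0_iff)
      then show ?thesis using y by force
    qed
    ultimately show ?thesis by auto
  qed
  have "?Z = Cons 0 ` ?W" if ?C
  proof -
    have type: "has_path_type r (0 # y) m \<longleftrightarrow> set y \<subseteq> {1..int r} \<and> walk_content y = m"
      if "set y \<subseteq> {1..}" for y
    proof -
      have "set y \<subseteq> {1..int r} \<longleftrightarrow> (\<forall>i\<in>{1..<length (0 # y)}. (0 # y) ! i \<le> int r)"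
      proof -
        have "set y \<subseteq> {1..int r} \<longleftrightarrow> (\<forall>i<length y. y ! i \<le> int r)"
          using that by (force simp: subset_iff in_set_conv_nth)
        also have "\<dots> \<longleftrightarrow> (\<forall>i\<in>{1..<length (0 # y)}. (0 # y) ! i \<le> int r)"
          using ball_Suc_iff[of "length y" "\<lambda>i. (0 # y) ! i \<le> int r"]
          by (simp add: atLeastLessThanSuc_atLeastAtMost)
        finally show ?thesis .
      qed
      moreover have "(\<forall>j\<in>{1..r}. count_list y (int j) = Poly_Mapping.lookup m j) \<longleftrightarrow>
          walk_content y = m" if "set y \<subseteq> {1..int r}"
      proof -
        have lk: "Poly_Mapping.lookup (walk_content y) i = count_list y (int i)" for i
          using lookup_walk_content[of y i] that by force
        \<comment> \<open>The type constrains only levels in \<open>{1..r}\<close>. At other levels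
          both sides are 0, by the bound on \<open>y\<close> and by \<open>?C\<close>.\<close>
        have "count_list y (int j) = Poly_Mapping.lookup m j" if "j \<notin> {1..r}" for j
        proof -
          have "int j \<notin> set y" using \<open>set y \<subseteq> {1..int r}\<close> that by force
          moreover have "j \<notin> Poly_Mapping.keys m" using \<open>?C\<close> that by blast
          ultimately show ?thesis by (simp add: in_keys_iff count_list_0_iff)
        qed
        then show ?thesis unfolding poly_mapping_eq_iff fun_eq_iff lk by blast
      qed
      ultimately show ?thesis unfolding has_path_type_def card_positions_Cons by blast
    qed
    have Cons: "0 # y \<in> ?Z \<longleftrightarrow> y \<in> ?W" for y
    proof -
      have "{1..int r} \<subseteq> {1..}" by auto
      then show ?thesis
        using type[of y] augmented_catalan_path_iff[OF assms, of y]
        by (auto simp: strip_walks_def)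
    qed
    have "\<exists>y. z = 0 # y" if "z \<in> ?Z" for z
      using that by (cases z) (auto simp: augmented_catalan_path_def)
    then show ?thesis using Cons by blast
  qed
  then have inside: "card ?Z = card ?W" if ?C using that by (simp add: card_image)
  have outside: "?W = {}" if "\<not> ?C" using C that by blast
  have "(if ?C then int (card ?Z) else 0) = int (card ?W)"
  proof (cases ?C)
    case True
    show ?thesis unfolding if_P[OF True] inside[OF True] ..
  next
    case False
    show ?thesis unfolding if_not_P[OF False] outside[OF False] by simp
  qed
  then show "mcoeff (catalan_type_series k r) m = mcoeff (walk_series k r 1) m"
    unfolding catalan_type_series_def mcoeff_walk_series Abs_mfps_inverse[OF UNIV_I]
      catalan_type_number_def .
qed

theorem theorem3p9:
  fixes k r :: nat
  assumes "k \<ge> 2" and "r \<ge> 1"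
  shows "catalan_type_series k r =
           mfps_X 1 * catalan_denominator k 2 r / catalan_denominator k 1 r"
proof -
  let ?Q = "catalan_denominator k 1 r"
  \<comment> \<open>\<open>inverse\<close> defaults to 0 on non-units, so invertibility comes
    first.\<close>
  have "?Q dvd 1"
    using assms by (intro mfps_is_unit mcoeff_catalan_denominator_zero) simp
  then have Q: "?Q * inverse ?Q = 1" by (rule mfps_inverse_right)
  have "catalan_type_series k r * ?Q = mfps_X 1 * catalan_denominator k 2 r"
    using walk_series_times_denominator[of k 1 r] assms
    by (simp add: catalan_type_series_eq_walk_series numeral_2_eq_2)
  then show ?thesis
    unfolding divide_mfps_def by (metis Q mult.assoc mult.right_neutral)
qed

end
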